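(* Let $\ell, m\geq 2$ be integers, and let $a, b\geq 1$ be odd integers with $s(a)=\ell$ and $s(b)=m$. If $s(ab)=2$, then $$ab<2^{-4+2\ell m}.$$
   Context: For a positive integer $n$, $s(n)$ denotes the number of nonzero digits in the binary expansion of $n$ (e.g. $s(23)=s((10111)_2)=4$). *)

theory Defs
  imports Complex_Main
begin

(* bit n i holds iff the coefficient of 2^i in the binary expansion of n is 1;
   for n :: nat only finitely many such i exist, so card is meaningful here. *)
definition nonzero_binary_digits :: "nat \<Rightarrow> nat" where
  "nonzero_binary_digits n = card {i. bit n i}"

end

theory Submission
  imports Defs
begin

text \<open>
  Write \<open>s\<close> for the number of nonzero binary digits. Two facts carry the proof: every odd
  number with \<open>s = 2\<close> is of the form \<open>2^k + 1\<close>, and \<open>s\<close> is subadditive and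
  submultiplicative, because carries can only reduce the number of nonzero digits.

  Let \<open>a * b = 2^k + 1\<close>, and write \<open>a = 1 + 2^e * u\<close> and \<open>b = 1 + 2^f * v\<close> with \<open>u\<close>, \<open>v\<close> odd.
  Comparing powers of two in \<open>a * b - 1 = 2^k\<close> forces \<open>e = f\<close>, so that
  \<open>u + v + 2^e * u * v = 2^r\<close> with \<open>k = e + r\<close>. Subtracting 1 turns the right-hand side
  into a number with \<open>r\<close> nonzero digits, whereas the left-hand side \<open>(u - 1) + v + 2^e * u * v\<close>
  has at most \<open>(l - 2) + (m - 1) + (l - 1) * (m - 1) = l * m - 2\<close> of them. Hence
  \<open>r \<le> l * m - 2\<close>. Moreover \<open>2^e \<le> 2^e * u * v < 2^r\<close>, so \<open>e < r\<close>, and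
  altogether \<open>k = e + r \<le> 2 * r - 1 \<le> 2 * l * m - 5\<close>.

  For \<open>l = m = 2\<close> the bound on \<open>k\<close> is attained by \<open>3 * 3 = 2^3 + 1\<close>.
\<close>

section \<open>Recursion for the number of nonzero digits\<close>

lemma finite_bits_nat: "finite {i. bit (n::nat) i}"
proof (rule finite_subset)
  show "{i. bit n i} \<subseteq> {..<n}"
  proof
    fix i assume "i \<in> {i. bit n i}"
    then have "n div 2 ^ i \<noteq> 0"
      by (auto simp: bit_iff_odd intro: odd_pos)
    then have "2 ^ i \<le> n"
      by (metis div_less not_le)
    then show "i \<in> {..<n}"
      using less_exp[of i] unfolding lessThan_iff by linarith
  qed
qed simp

lemma nonzero_binary_digits_0 [simp]: "nonzero_binary_digits 0 = 0"
  by (simp add: nonzero_binary_digits_def)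

lemma nonzero_binary_digits_double [simp]:
  "nonzero_binary_digits (2 * n) = nonzero_binary_digits n"
proof -
  have "{i. bit (2 * n) i} = Suc ` {i. bit n i}"
  proof (rule set_eqI)
    fix i show "i \<in> {i. bit (2 * n) i} \<longleftrightarrow> i \<in> Suc ` {i. bit n i}"
      by (cases i) (auto simp: bit_Suc bit_0)
  qed
  then show ?thesis
    by (simp add: nonzero_binary_digits_def card_image)
qed

lemma nonzero_binary_digits_Suc_even:
  assumes "even n"
  shows "nonzero_binary_digits (Suc n) = Suc (nonzero_binary_digits n)"
proof -
  have "{i. bit (Suc n) i} = insert 0 {i. bit n i}"
  proof (rule set_eqI)
    fix i show "i \<in> {i. bit (Suc n) i} \<longleftrightarrow> i \<in> insert 0 {i. bit n i}"
      using assms by (cases i) (auto simp: bit_Suc bit_0)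
  qed
  then show ?thesis
    using assms by (simp add: nonzero_binary_digits_def finite_bits_nat bit_0)
qed

lemma nonzero_binary_digits_double_Suc [simp]:
  "nonzero_binary_digits (Suc (2 * n)) = Suc (nonzero_binary_digits n)"
  by (simp add: nonzero_binary_digits_Suc_even)

lemma nonzero_binary_digits_power2_mult [simp]:
  "nonzero_binary_digits (2 ^ e * n) = nonzero_binary_digits n"
  by (induction e) (simp_all add: mult.assoc)

lemma nonzero_binary_digits_pred_odd:
  assumes "odd n"
  shows "nonzero_binary_digits n = Suc (nonzero_binary_digits (n - 1))"
  using assms by (auto elim!: oddE)

lemma nonzero_binary_digits_power2_minus_1:
  "nonzero_binary_digits (2 ^ r - 1) = r"
proof (induction r)
  case (Suc r)
  have "(2::nat) ^ Suc r - 1 = Suc (2 * (2 ^ r - 1))"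
    using one_le_power[of "2::nat" r] unfolding power_Suc by linarith
  then show ?case
    using Suc.IH by simp
qed simp

section \<open>Subadditivity and submultiplicativity\<close>

lemma nat_binary_cases:
  obtains k where "n = 2 * k" | k where "n = Suc (2 * k)"
  by (metis evenE oddE Suc_eq_plus1)

lemma nonzero_binary_digits_Suc_le:
  "nonzero_binary_digits (Suc n) \<le> Suc (nonzero_binary_digits n)"
proof (induction n rule: less_induct)
  case (less n)
  show ?case
  proof (cases n rule: nat_binary_cases)
    case (2 k)
    have "Suc n = 2 * Suc k" using 2 by simp
    then have "nonzero_binary_digits (Suc n) = nonzero_binary_digits (Suc k)"
      by (simp only: nonzero_binary_digits_double)
    then show ?thesis
      using less.IH[of k] 2 by simp
  qed simp
qed

text \<open>
  Induction on the binary expansion of both summands; when both are odd, the carry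
  out of the last place adds at most one digit to the sum of the halves, while the two
  summands have two digits more than their halves.
\<close>

lemma nonzero_binary_digits_add_le:
  "nonzero_binary_digits (x + y) \<le> nonzero_binary_digits x + nonzero_binary_digits y"
proof (induction x arbitrary: y rule: less_induct)
  case (less x)
  show ?case
  proof (cases "x = 0")
    case False
    show ?thesis
    proof (cases x rule: nat_binary_cases)
      case x: (1 p)
      have IH: "nonzero_binary_digits (p + q) \<le> nonzero_binary_digits p + nonzero_binary_digits q" for q
        using less.IH[of p] x False by simp
      show ?thesis
      proof (cases y rule: nat_binary_cases)
        case (1 q)
        then have "x + y = 2 * (p + q)" using x by simp
        then show ?thesis
          using IH[of q] x 1 by (simp del: distrib_left_numeral)
      next
        case (2 q)
        then have "x + y = Suc (2 * (p + q))" using x by simp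
        then show ?thesis
          using IH[of q] x 2 by (simp del: distrib_left_numeral)
      qed
    next
      case x: (2 p)
      have IH: "nonzero_binary_digits (p + q) \<le> nonzero_binary_digits p + nonzero_binary_digits q" for q
        using less.IH[of p] x by simp
      show ?thesis
      proof (cases y rule: nat_binary_cases)
        case (1 q)
        then have "x + y = Suc (2 * (p + q))" using x by simp
        then show ?thesis
          using IH[of q] x 1 by (simp del: distrib_left_numeral)
      next
        case (2 q)
        then have "x + y = 2 * Suc (p + q)" using x by simp
        then have "nonzero_binary_digits (x + y) = nonzero_binary_digits (Suc (p + q))"
          by (simp only: nonzero_binary_digits_double)
        then show ?thesis
          using IH[of q] nonzero_binary_digits_Suc_le[of "p + q"] x 2 by simp
      qed
    qed
  qed simp
qed

text \<open>
  Schoolbook multiplication: \<open>x * y\<close> is a sum of shifted copies of \<open>y\<close>, one for each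
  nonzero digit of \<open>x\<close>.
\<close>

lemma nonzero_binary_digits_mult_le:
  "nonzero_binary_digits (x * y) \<le> nonzero_binary_digits x * nonzero_binary_digits y"
proof (induction x rule: less_induct)
  case (less x)
  show ?case
  proof (cases "x = 0")
    case False
    show ?thesis
    proof (cases x rule: nat_binary_cases)
      case (1 p)
      then show ?thesis
        using less.IH[of p] False by (simp add: mult.assoc)
    next
      case (2 p)
      have "nonzero_binary_digits (x * y) = nonzero_binary_digits (y + 2 * (p * y))"
        using 2 by (simp add: mult.assoc)
      also have "\<dots> \<le> nonzero_binary_digits y + nonzero_binary_digits (p * y)"
        using nonzero_binary_digits_add_le[of y "2 * (p * y)"] by simp
      also have "\<dots> \<le> nonzero_binary_digits x * nonzero_binary_digits y"
        using less.IH[of p] 2 by simp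
      finally show ?thesis .
    qed
  qed simp
qed

section \<open>Powers of two and odd parts\<close>

lemma power2_odd_decomposition:
  assumes "n > (0::nat)"
  obtains e q where "n = 2 ^ e * q" and "odd q"
  using assms
proof (induction n arbitrary: thesis rule: less_induct)
  case (less n)
  show ?case
  proof (cases "even n")
    case True
    then obtain k where k: "n = 2 * k" by blast
    with less.prems have "k < n" "k > 0" by auto
    from less.IH[OF this(1) _ this(2)] obtain e q where "k = 2 ^ e * q" "odd q" by blast
    with k show ?thesis by (intro less.prems(1)[of "Suc e" q]) auto
  next
    case False
    then show ?thesis by (intro less.prems(1)[of 0 n]) auto
  qed
qed

lemma nonzero_binary_digits_eq_1_imp_power2:
  assumes "nonzero_binary_digits n = 1"
  obtains k where "n = 2 ^ k"
proof -
  have "n > 0"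
    using assms by (cases n) auto
  then obtain k q where kq: "n = 2 ^ k * q" "odd q"
    by (rule power2_odd_decomposition)
  have "nonzero_binary_digits (q - 1) = 0"
    using assms kq nonzero_binary_digits_pred_odd[of q] by simp
  then have "{i. bit (q - 1) i} = {}"
    by (simp add: nonzero_binary_digits_def finite_bits_nat)
  then have "q - 1 = 0"
    by (intro bit_eqI) simp
  with kq have "q = 1"
    using odd_pos[of q] by simp
  with kq show thesis
    by (intro that[of k]) simp
qed

lemma odd_part_of_power2:
  assumes "2 ^ e * q = (2::nat) ^ k" and "odd q"
  shows "q = 1"
proof -
  have "coprime q (2 ^ k)" using assms(2) by simp
  moreover have "q dvd 2 ^ k" using assms(1) by (metis dvd_triv_right)
  ultimately show ?thesis
    by (metis coprime_absorb_left nat_dvd_1_iff_1)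
qed

section \<open>Products of the form \<open>2^k + 1\<close>\<close>

text \<open>
  If \<open>e < f\<close>, then \<open>2^e\<close> exactly divides the product minus 1, because \<open>u\<close> is odd. The
  odd cofactor is larger than \<open>u\<close>, so it exceeds 1, which is impossible in a power of two.
\<close>

lemma product_power2_plus_1_exponent_le:
  fixes e f u v k :: nat
  assumes "(1 + 2 ^ e * u) * (1 + 2 ^ f * v) = 2 ^ k + 1"
    and "odd u" and "v > 0"
  shows "f \<le> e"
proof (rule ccontr)
  assume "\<not> f \<le> e"
  then obtain d where d: "f = e + Suc d"
    by (metis add_Suc_right less_imp_Suc_add not_le)
  let ?w = "2 ^ Suc d * (v * (1 + 2 ^ e * u))"
  have "2 ^ e * (u + ?w) = 2 ^ k"
    using assms(1) by (simp add: d power_add algebra_simps)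
  moreover have "odd (u + ?w)" using assms(2) by simp
  ultimately have "u + ?w = 1" by (rule odd_part_of_power2)
  moreover have "u > 0" "?w > 0" using assms(2,3) odd_pos by auto
  ultimately show False by linarith
qed

text \<open>
  Subtracting 1 from \<open>2^r\<close> turns a single nonzero digit into \<open>r\<close> of them, whereas
  subtracting 1 from the odd number \<open>u\<close> on the other side removes a digit. So the \<open>r\<close> digits
  have to come from the three summands.
\<close>

lemma power2_exponent_le_digits:
  assumes "u + v + 2 ^ e * (u * v) = 2 ^ r" and "odd u"
  shows "Suc r \<le> nonzero_binary_digits u + nonzero_binary_digits v
    + nonzero_binary_digits u * nonzero_binary_digits v"
proof -
  have "2 ^ r - 1 = (u - 1) + v + 2 ^ e * (u * v)"
    using assms(1) odd_pos[OF assms(2)] by linarith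
  then have "r = nonzero_binary_digits ((u - 1) + v + 2 ^ e * (u * v))"
    by (metis nonzero_binary_digits_power2_minus_1)
  also have "\<dots> \<le> nonzero_binary_digits ((u - 1) + v) + nonzero_binary_digits (u * v)"
    using nonzero_binary_digits_add_le[of "(u - 1) + v" "2 ^ e * (u * v)"] by simp
  also have "\<dots> \<le> nonzero_binary_digits (u - 1) + nonzero_binary_digits v
      + nonzero_binary_digits u * nonzero_binary_digits v"
    by (intro add_mono nonzero_binary_digits_add_le nonzero_binary_digits_mult_le)
  finally show ?thesis
    using nonzero_binary_digits_pred_odd[OF assms(2)] by simp
qed

lemma odd_decomposition_plus_1:
  assumes "odd n" and "nonzero_binary_digits n \<ge> 2"
  obtains e q where "n = 1 + 2 ^ e * q" and "odd q"
    and "nonzero_binary_digits n = Suc (nonzero_binary_digits q)"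
proof -
  have n: "nonzero_binary_digits n = Suc (nonzero_binary_digits (n - 1))"
    using assms(1) by (rule nonzero_binary_digits_pred_odd)
  with assms(2) have "n - 1 > 0"
    by (cases "n - 1 = 0") auto
  then obtain e q where "n - 1 = 2 ^ e * q" "odd q"
    by (rule power2_odd_decomposition)
  with n \<open>n - 1 > 0\<close> show thesis
    by (intro that[of e q]) auto
qed

theorem theorem2p1:
  fixes l m a b :: nat
  assumes "l \<ge> 2" and "m \<ge> 2"
    and "a \<ge> 1" and "b \<ge> 1"
    and "odd a" and "odd b"
    and "nonzero_binary_digits a = l" and "nonzero_binary_digits b = m"
    and "nonzero_binary_digits (a * b) = 2"
  shows "real (a * b) < 2 powi (-4 + 2 * int l * int m)"
proof -
  obtain e u where a: "a = 1 + 2 ^ e * u" "odd u" "l = Suc (nonzero_binary_digits u)"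
    using odd_decomposition_plus_1[of a] assms by metis
  obtain f v where b: "b = 1 + 2 ^ f * v" "odd v" "m = Suc (nonzero_binary_digits v)"
    using odd_decomposition_plus_1[of b] assms by metis
  have pos: "u > 0" "v > 0" using a b odd_pos by auto
  have "odd (a * b)" using assms by simp
  then have "nonzero_binary_digits (a * b - 1) = 1"
    using nonzero_binary_digits_pred_odd[of "a * b"] assms by simp
  then obtain k where "a * b - 1 = 2 ^ k"
    by (rule nonzero_binary_digits_eq_1_imp_power2)
  then have k: "a * b = 2 ^ k + 1"
    using odd_pos[OF \<open>odd (a * b)\<close>] by linarith
  have "f \<le> e"
    using product_power2_plus_1_exponent_le[of e u f v k] k a b pos by simp
  moreover have "e \<le> f"
    using product_power2_plus_1_exponent_le[of f v e u k] k a b pos by (simp add: mult.commute)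
  ultimately have "f = e" by simp
  let ?t = "u + v + 2 ^ e * (u * v)"
  have t: "2 ^ e * ?t = 2 ^ k"
    using k a(1) b(1) \<open>f = e\<close> by (simp add: algebra_simps)
  then have "(2::nat) ^ e dvd 2 ^ k" by (metis dvd_triv_left)
  then have "e \<le> k" by (simp add: power_dvd_imp_le)
  define r where "r = k - e"
  have kr: "k = e + r" using \<open>e \<le> k\<close> by (simp add: r_def)
  then have r: "?t = 2 ^ r" using t by (simp add: power_add)
  have "Suc r \<le> (l - 1) + (m - 1) + (l - 1) * (m - 1)"
    using power2_exponent_le_digits[OF r a(2)] a(3) b(3) by simp
  also have "\<dots> = l * m - 1"
    using a(3) b(3) by simp
  finally have r_le: "r + 2 \<le> l * m" by simp
  have "(2::nat) ^ e \<le> 2 ^ e * (u * v)" using pos by simp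
  then have "(2::nat) ^ e < 2 ^ r" using r pos by linarith
  then have "e < r" by simp
  with r_le kr have k_le: "k + 5 \<le> 2 * (l * m)" by linarith
  have "k > 0" using kr \<open>e < r\<close> by simp
  then have "a * b < 2 ^ Suc k"
    using k one_less_power[of "2::nat" k] by simp
  then have "a * b < 2 ^ (2 * (l * m) - 4)"
    using k_le power_increasing[of "Suc k" "2 * (l * m) - 4" "2::nat"] by linarith
  then have "real (a * b) < 2 ^ (2 * (l * m) - 4)"
    by (metis of_nat_less_iff of_nat_numeral of_nat_power)
  moreover have "-4 + 2 * int l * int m = int (2 * (l * m) - 4)"
    using k_le by (simp add: of_nat_diff)
  ultimately show ?thesis
    by (simp only: power_int_of_nat)
qed

end
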